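(* Let $g\ge1$ and fix an admissible decomposition $\Sigma$ of $\Omega_g^{\rm rt}$. The action of $\operatorname{GL}_g(\mathbb Z)$ on the stacky fan ${}^\Sigma\mathbb H_g^{tr}$ (resp. on the ideal stacky fan ${}^\Sigma\mathbb H_g^{tr,p}$) given by changing the markings, $(V/\Lambda,Q,\phi)\cdot M=(V/\Lambda,Q,\phi\circ M)$ for $M\in\operatorname{GL}_g(\mathbb Z)$, is admissible.
   Context: In the space $\mathbb R^{\binom{g+1}2}$ of quadratic forms on $\mathbb R^g$ (symmetric $g\times g$ matrices, with lattice the integral symmetric matrices), $\Omega_g$ is the cone of positive definite forms and $\Omega_g^{\rm rt}$ is the cone of positive semi-definite forms whose null space has a basis in $\mathbb Q^g$. An admissible decomposition $\Sigma$ of $\Omega_g^{\rm rt}$ is a collection of rational polyhedral cones contained in $\Omega_g^{\rm rt}$ such that: faces of cones of $\Sigma$ are in $\Sigma$; the intersection of two cones of $\Sigma$ is a face of both; if $\sigma\in\Sigma$ and $M\in\operatorname{GL}_g(\mathbb Z)$ then $M\sigma M^t\in\Sigma$; there are finitely many $\operatorname{GL}_g(\mathbb Z)$-orbits of cones in $\Sigma$; and $\bigcup_{\sigma\in\Sigma}\sigma=\Omega_g^{\rm rt}$. Put $\Sigma_{|\Omega_g}=\{\sigma\cap\Omega_g:\sigma\in\Sigma,\ \sigma\cap\Omega_g\neq\emptyset\}$. ${}^\Sigma\mathbb H_g^{tr}$ (resp. ${}^\Sigma\mathbb H_g^{tr,p}$) is the topological space obtained from the disjoint union of the cones of $\Sigma$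 (resp. of $\Sigma_{|\Omega_g}$) by gluing along all face inclusions, with the quotient topology; it is a stacky fan (resp. ideal stacky fan). Its points are isomorphism classes of marked (resp. marked pure) tropical p.p. abelian varieties $(V/\Lambda,Q,\phi)$ of dimension $g$: $V$ a $g$-dimensional real vector space, $\Lambda\subset V$ a full lattice, $Q$ a positive semi-definite (resp. positive definite) quadratic form on $V$ with null space defined over $\Lambda\otimes\mathbb Q$, $\phi:\mathbb R^g\to V$ a linear isomorphism with $\phi(\mathbb Z^g)=\Lambda$; the correspondence is $(V/\Lambda,Q,\phi)\leftrightarrow\phi^*(Q)$, a point of a cone of $\Sigma$. An action of a group $G$ on a space $X=(\coprod\sigma_i)/\!\sim$ glued from (ideal) cones is admissible if for each $\gamma\in G$ and each cone $\sigma_i$ there are a cone $\sigma_j$ and a linear isomorphism $L:\sigma_i\to\sigma_j$ which maps the lattice points of $\operatorname{span}\sigma_i$ onto the lattice points of $\operatorname{span}\sigma_j$, such that $\sigma_i\to X\xrightarrow{\gamma}X$ equals $\sigma_i\xrightarrow{L}\sigma_j\to X$. *)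

theory Defs
  imports "HOL-Analysis.Analysis" "HOL-Algebra.Group"
begin

section \<open>Quadratic forms and admissible decompositions\<close>

text \<open>
  Quadratic forms on \<open>\<real>\<^sup>g\<close> are symmetric matrices of type \<open>real^'g^'g\<close>, where \<open>g = CARD('g) \<ge> 1\<close>.
\<close>

definition integer_vectors :: "(real^'g) set" where
  "integer_vectors = {x. \<forall>i. x $ i \<in> \<int>}"

definition rational_vectors :: "(real^'g) set" where
  "rational_vectors = {x. \<forall>i. x $ i \<in> \<rat>}"

definition symmetric_matrices :: "(real^'g^'g) set" where
  "symmetric_matrices = {A. transpose A = A}"

definition integral_symmetric_matrices :: "(real^'g^'g) set" where
  "integral_symmetric_matrices = {A \<in> symmetric_matrices. \<forall>i j. A $ i $ j \<in> \<int>}"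

definition Omega :: "(real^'g^'g) set" where
  "Omega = {A \<in> symmetric_matrices. \<forall>x. x \<noteq> 0 \<longrightarrow> x \<bullet> (A *v x) > 0}"

definition Omega_rt :: "(real^'g^'g) set" where
  "Omega_rt = {A \<in> symmetric_matrices.
     (\<forall>x. x \<bullet> (A *v x) \<ge> 0) \<and>
     (\<exists>B \<subseteq> rational_vectors. independent B \<and> span B = {x. A *v x = 0})}"

definition rational_polyhedral_cone :: "(real^'g^'g) set \<Rightarrow> bool" where
  "rational_polyhedral_cone \<sigma> \<longleftrightarrow>
     (\<exists>S. finite S \<and> S \<subseteq> integral_symmetric_matrices \<and> \<sigma> = convex_cone hull S)"

definition GL_int :: "(int^'g^'g) monoid" where
  "GL_int = \<lparr>carrier = {M. invertible M}, monoid.mult = (**), one = mat 1\<rparr>"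

definition cone_transform :: "int^'g^'g \<Rightarrow> (real^'g^'g) set \<Rightarrow> (real^'g^'g) set" where
  "cone_transform M \<sigma> =
     (\<lambda>A. map_matrix of_int M ** A ** transpose (map_matrix of_int M)) ` \<sigma>"

text \<open>
  The library counts \<open>{}\<close> as a face of every set, hence the side condition \<open>\<tau> \<noteq> {}\<close>; the nonempty
  convex faces of a polyhedral cone are exactly those cut out by supporting hyperplanes.
\<close>

definition admissible_decomposition :: "(real^'g^'g) set set \<Rightarrow> bool" where
  "admissible_decomposition \<Sigma> \<longleftrightarrow>
     (\<forall>\<sigma>\<in>\<Sigma>. rational_polyhedral_cone \<sigma> \<and> \<sigma> \<subseteq> Omega_rt) \<and>
     (\<forall>\<sigma>\<in>\<Sigma>. \<forall>\<tau>. \<tau> face_of \<sigma> \<and> \<tau> \<noteq> {} \<longrightarrow> \<tau> \<in> \<Sigma>) \<and>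
     (\<forall>\<sigma>\<in>\<Sigma>. \<forall>\<tau>\<in>\<Sigma>. (\<sigma> \<inter> \<tau>) face_of \<sigma> \<and> (\<sigma> \<inter> \<tau>) face_of \<tau>) \<and>
     (\<forall>\<sigma>\<in>\<Sigma>. \<forall>M\<in>carrier GL_int. cone_transform M \<sigma> \<in> \<Sigma>) \<and>
     finite ((\<lambda>\<sigma>. {cone_transform M \<sigma> | M. M \<in> carrier GL_int}) ` \<Sigma>) \<and>
     \<Union>\<Sigma> = Omega_rt"

definition restrict_to_Omega :: "(real^'g^'g) set set \<Rightarrow> (real^'g^'g) set set" where
  "restrict_to_Omega \<Sigma> = {\<sigma> \<inter> Omega | \<sigma>. \<sigma> \<in> \<Sigma> \<and> \<sigma> \<inter> Omega \<noteq> {}}"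


section \<open>Spaces glued from cones\<close>

definition quotient_topology :: "'a topology \<Rightarrow> 'a rel \<Rightarrow> 'a set topology" where
  "quotient_topology X r =
     topology (\<lambda>U. U \<subseteq> topspace X // r \<and> openin X {x \<in> topspace X. r `` {x} \<in> U})"

lemma openin_quotient_topology:
  "openin (quotient_topology X r) U \<longleftrightarrow>
     U \<subseteq> topspace X // r \<and> openin X {x \<in> topspace X. r `` {x} \<in> U}"
proof -
  have "istopology (\<lambda>U. U \<subseteq> topspace X // r \<and> openin X {x \<in> topspace X. r `` {x} \<in> U})"
    unfolding istopology_def
  proof (intro conjI allI impI)
    fix S T
    assume S: "S \<subseteq> topspace X // r \<and> openin X {x \<in> topspace X. r `` {x} \<in> S}"
      and T: "T \<subseteq> topspace X // r \<and> openin X {x \<in> topspace X. r `` {x} \<in> T}"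
    have eq: "{x \<in> topspace X. r `` {x} \<in> S \<inter> T} =
        {x \<in> topspace X. r `` {x} \<in> S} \<inter> {x \<in> topspace X. r `` {x} \<in> T}"
      by blast
    show "S \<inter> T \<subseteq> topspace X // r" using S by blast
    show "openin X {x \<in> topspace X. r `` {x} \<in> S \<inter> T}"
      unfolding eq using S T by blast
  next
    fix \<K>
    assume K: "\<forall>K\<in>\<K>. K \<subseteq> topspace X // r \<and> openin X {x \<in> topspace X. r `` {x} \<in> K}"
    have eq: "{x \<in> topspace X. r `` {x} \<in> \<Union>\<K>} = (\<Union>K\<in>\<K>. {x \<in> topspace X. r `` {x} \<in> K})"
      by blast
    show "\<Union>\<K> \<subseteq> topspace X // r" using K by blast
    show "openin X {x \<in> topspace X. r `` {x} \<in> \<Union>\<K>}"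
      unfolding eq using K by (intro openin_Union) blast
  qed
  then show ?thesis
    by (simp add: quotient_topology_def topology_inverse')
qed

lemma topspace_quotient_topology [simp]: "topspace (quotient_topology X r) = topspace X // r"
proof -
  have "{x \<in> topspace X. r `` {x} \<in> topspace X // r} = topspace X"
    by (auto intro: quotientI)
  then have "openin (quotient_topology X r) (topspace X // r)"
    by (simp add: openin_quotient_topology)
  then show ?thesis
    using openin_quotient_topology[of X r "topspace (quotient_topology X r)"] openin_subset
    by fastforce
qed

lemma quotient_map_quotient_topology:
  "quotient_map X (quotient_topology X r) (\<lambda>x. r `` {x})"
  by (auto simp: quotient_map_def openin_quotient_topology quotient_def)

text \<open>
  A point of the disjoint union of a family \<open>K\<close> of (ideal) cones is a pair \<open>(\<sigma>, x)\<close> with \<open>\<sigma> \<in> K\<close> and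
  \<open>x \<in> \<sigma>\<close>.  The same definition serves \<^term>\<open>restrict_to_Omega \<Sigma>\<close>: since \<^term>\<open>Omega\<close> is relatively
  open in the symmetric matrices, the nonempty convex faces of \<open>\<sigma> \<inter> Omega\<close> are the nonempty sets
  \<open>\<tau> \<inter> Omega\<close> with \<open>\<tau>\<close> a face of \<open>\<sigma>\<close>.
\<close>

definition face_gluing :: "'a::real_normed_vector set set \<Rightarrow> ('a set \<times> 'a) rel" where
  "face_gluing K =
     (let F = {((\<tau>, x), (\<sigma>, x)) | \<tau> \<sigma> x. \<tau> \<in> K \<and> \<sigma> \<in> K \<and> \<tau> face_of \<sigma> \<and> x \<in> \<tau>}
      in (F \<union> F\<inverse>)\<^sup>*)"

definition glued_space :: "'a::real_normed_vector set set \<Rightarrow> ('a set \<times> 'a) set topology" where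
  "glued_space K = quotient_topology (sum_topology top_of_set K) (face_gluing K)"

definition glued_class :: "'a::real_normed_vector set set \<Rightarrow> 'a set \<Rightarrow> 'a \<Rightarrow> ('a set \<times> 'a) set" where
  "glued_class K \<sigma> x = face_gluing K `` {(\<sigma>, x)}"

abbreviation stacky_fan ::
    "(real^'g^'g) set set \<Rightarrow> ((real^'g^'g) set \<times> (real^'g^'g)) set topology" where
  "stacky_fan \<Sigma> \<equiv> glued_space \<Sigma>"

abbreviation ideal_stacky_fan ::
    "(real^'g^'g) set set \<Rightarrow> ((real^'g^'g) set \<times> (real^'g^'g)) set topology" where
  "ideal_stacky_fan \<Sigma> \<equiv> glued_space (restrict_to_Omega \<Sigma>)"


section \<open>Admissible actions\<close>

definition right_action :: "('m, 'n) monoid_scheme \<Rightarrow> 'x topology \<Rightarrow> ('m \<Rightarrow> 'x \<Rightarrow> 'x) \<Rightarrow> bool" where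
  "right_action G X act \<longleftrightarrow>
     (\<forall>\<gamma>\<in>carrier G. continuous_map X X (act \<gamma>)) \<and>
     (\<forall>p\<in>topspace X. act \<one>\<^bsub>G\<^esub> p = p) \<and>
     (\<forall>\<gamma>\<in>carrier G. \<forall>\<delta>\<in>carrier G. \<forall>p\<in>topspace X. act (\<gamma> \<otimes>\<^bsub>G\<^esub> \<delta>) p = act \<delta> (act \<gamma> p))"

text \<open>
  A linear isomorphism \<open>span \<sigma> \<rightarrow> span \<tau>\<close> is given by a linear map \<open>L\<close> on the ambient space that is
  injective on \<^term>\<open>span \<sigma>\<close>; its values outside \<^term>\<open>span \<sigma>\<close> are irrelevant.
\<close>

definition lattice_cone_iso ::
    "'a::real_vector set \<Rightarrow> 'a set \<Rightarrow> 'a set \<Rightarrow> ('a \<Rightarrow> 'a) \<Rightarrow> bool" where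
  "lattice_cone_iso \<Gamma> \<sigma> \<tau> L \<longleftrightarrow>
     linear L \<and> inj_on L (span \<sigma>) \<and> L ` \<sigma> = \<tau> \<and> L ` (\<Gamma> \<inter> span \<sigma>) = \<Gamma> \<inter> span \<tau>"

definition admissible_action ::
    "('m, 'n) monoid_scheme \<Rightarrow> 'a::real_normed_vector set \<Rightarrow> 'a set set \<Rightarrow>
     ('m \<Rightarrow> ('a set \<times> 'a) set \<Rightarrow> ('a set \<times> 'a) set) \<Rightarrow> bool" where
  "admissible_action G \<Gamma> K act \<longleftrightarrow>
     group G \<and> right_action G (glued_space K) act \<and>
     (\<forall>\<gamma>\<in>carrier G. \<forall>\<sigma>\<in>K. \<exists>\<tau>\<in>K. \<exists>L. lattice_cone_iso \<Gamma> \<sigma> \<tau> L \<and>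
        (\<forall>x\<in>\<sigma>. act \<gamma> (glued_class K \<sigma> x) = glued_class K \<tau> (L x)))"


section \<open>Marked tropical p.p. abelian varieties\<close>

text \<open>
  In \<open>(V/\<Lambda>, Q, \<phi>)\<close> the space \<open>V\<close> is a subspace of an arbitrary ambient real vector space \<open>'v\<close>; the
  values of \<open>Q\<close> outside \<open>V\<close> are irrelevant.
\<close>

record ('g, 'v) marked_tav =
  vspace :: "'v set"
  period_lattice :: "'v set"
  qform :: "'v \<Rightarrow> real"
  marking :: "real^'g \<Rightarrow> 'v"

definition full_lattice :: "'v::real_vector set \<Rightarrow> 'v set \<Rightarrow> bool" where
  "full_lattice V \<Lambda> \<longleftrightarrow>
     (\<exists>B. finite B \<and> independent B \<and> span B = V \<and>
        \<Lambda> = {\<Sum>b\<in>B. of_int (c b) *\<^sub>R b | c. True})"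

definition quadratic_form_on :: "'v::real_vector set \<Rightarrow> ('v \<Rightarrow> real) \<Rightarrow> bool" where
  "quadratic_form_on V Q \<longleftrightarrow>
     (\<exists>b. (\<forall>u\<in>V. \<forall>v\<in>V. b u v = b v u) \<and>
        (\<forall>u\<in>V. \<forall>v\<in>V. \<forall>w\<in>V. b (u + v) w = b u w + b v w) \<and>
        (\<forall>c. \<forall>u\<in>V. \<forall>w\<in>V. b (c *\<^sub>R u) w = c * b u w) \<and>
        (\<forall>v\<in>V. Q v = b v v))"

text \<open>
  \<open>Q (v + w) - Q v - Q w\<close> is twice the value at \<open>(v, w)\<close> of the symmetric bilinear form of \<open>Q\<close>.
\<close>

definition null_space_of :: "'v::real_vector set \<Rightarrow> ('v \<Rightarrow> real) \<Rightarrow> 'v set" where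
  "null_space_of V Q = {v \<in> V. \<forall>w\<in>V. Q (v + w) = Q v + Q w}"

definition rational_span :: "'v::real_vector set \<Rightarrow> 'v set" where
  "rational_span \<Lambda> = {v. \<exists>n::nat. n > 0 \<and> real n *\<^sub>R v \<in> \<Lambda>}"

definition marked_tavs :: "('g::finite, 'v::real_vector) marked_tav set" where
  "marked_tavs = {A.
     subspace (vspace A) \<and> dim (vspace A) = CARD('g) \<and>
     full_lattice (vspace A) (period_lattice A) \<and>
     quadratic_form_on (vspace A) (qform A) \<and>
     (\<forall>v\<in>vspace A. qform A v \<ge> 0) \<and>
     (\<exists>B \<subseteq> rational_span (period_lattice A).
        independent B \<and> span B = null_space_of (vspace A) (qform A)) \<and>
     linear (marking A) \<and> bij_betw (marking A) UNIV (vspace A) \<and>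
     marking A ` integer_vectors = period_lattice A}"

definition marked_pure_tavs :: "('g::finite, 'v::real_vector) marked_tav set" where
  "marked_pure_tavs = {A \<in> marked_tavs. \<forall>v\<in>vspace A. v \<noteq> 0 \<longrightarrow> qform A v > 0}"

definition change_marking ::
    "int^'g^'g \<Rightarrow> ('g::finite, 'v::real_vector) marked_tav \<Rightarrow> ('g, 'v) marked_tav" where
  "change_marking M A = A\<lparr>marking := marking A \<circ> (\<lambda>x. map_matrix of_int M *v x)\<rparr>"

definition form_matrix :: "(real^'g \<Rightarrow> real) \<Rightarrow> real^'g^'g" where
  "form_matrix q = (\<chi> i j. (q (axis i 1 + axis j 1) - q (axis i 1) - q (axis j 1)) / 2)"

lemma form_matrix_eq:
  assumes "transpose A = A"
  shows "form_matrix (\<lambda>x. x \<bullet> (A *v x)) = A"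
proof -
  have e: "axis i 1 \<bullet> (A *v axis j 1) = A $ i $ j" for i j
    by (simp add: inner_axis' matrix_vector_mul_component inner_axis)
  have s: "A $ j $ i = A $ i $ j" for i j
    using assms by (metis transpose_def vec_lambda_beta)
  show ?thesis
    by (simp add: form_matrix_def vec_eq_iff matrix_vector_right_distrib inner_add_left
        inner_add_right e s)
qed

text \<open>
  The point of the glued space corresponding to \<open>(V/\<Lambda>, Q, \<phi>)\<close>: the class of \<open>\<phi>\<^sup>*(Q)\<close> in any cone of
  \<open>K\<close> containing it.
\<close>

definition moduli_point ::
    "(real^'g^'g) set set \<Rightarrow> ('g::finite, 'v::real_vector) marked_tav \<Rightarrow>
     ((real^'g^'g) set \<times> (real^'g^'g)) set" where
  "moduli_point K A =
     (let x = form_matrix (qform A \<circ> marking A)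
      in THE p. \<exists>\<sigma>\<in>K. x \<in> \<sigma> \<and> p = glued_class K \<sigma> x)"

text \<open>
  The action on the glued space induced by changing the markings of the objects in \<open>T\<close>.  Every
  isomorphism class has a representative with \<open>V = \<real>\<^sup>g\<close>, so those suffice to define it.
\<close>

definition marking_action ::
    "('g::finite, real^'g) marked_tav set \<Rightarrow> (real^'g^'g) set set \<Rightarrow> int^'g^'g \<Rightarrow>
     ((real^'g^'g) set \<times> (real^'g^'g)) set \<Rightarrow> ((real^'g^'g) set \<times> (real^'g^'g)) set" where
  "marking_action T K M p =
     (THE q. \<forall>A\<in>T. moduli_point K A = p \<longrightarrow> q = moduli_point K (change_marking M A))"

definition siegel_action ::
    "(real^'g^'g) set set \<Rightarrow> int^'g^'g \<Rightarrow>
     ((real^'g^'g) set \<times> (real^'g^'g)) set \<Rightarrow> ((real^'g^'g) set \<times> (real^'g^'g)) set" where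
  "siegel_action \<Sigma> = marking_action marked_tavs \<Sigma>"

definition pure_siegel_action ::
    "(real^'g^'g) set set \<Rightarrow> int^'g^'g \<Rightarrow>
     ((real^'g^'g) set \<times> (real^'g^'g)) set \<Rightarrow> ((real^'g^'g) set \<times> (real^'g^'g)) set" where
  "pure_siegel_action \<Sigma> = marking_action marked_pure_tavs (restrict_to_Omega \<Sigma>)"

end

theory Submission
  imports Defs
begin

text \<open>
  Two cones of the decomposition meet in a common face, so the gluing identifies \<open>(\<sigma>, x)\<close> with
  \<open>(\<tau>, y)\<close> exactly when \<open>x = y\<close>; hence a point of the glued space is the same as a form in the union
  of the cones.  Since \<open>(\<phi> \<circ> M)\<^sup>* Q = M\<^sup>t \<phi>\<^sup>*(Q) M\<close>, changing the marking is induced by the linear maps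
  \<open>X \<mapsto> M\<^sup>t X M\<close>, which permute the cones because \<open>M\<^sup>t \<in> GL\<^sub>g(\<int>)\<close>, preserve the lattice together with
  their inverses, and map \<^term>\<open>Omega\<close> onto itself.
\<close>

section \<open>Integral base change of quadratic forms\<close>

abbreviation real_matrix :: "int^'n^'m \<Rightarrow> real^'n^'m" where
  "real_matrix \<equiv> map_matrix of_int"

lemma real_matrix_mult: "real_matrix (M ** N) = real_matrix M ** real_matrix N"
  by (simp add: vec_eq_iff matrix_matrix_mult_def)

lemma real_matrix_one: "real_matrix (mat 1) = mat 1"
  by (simp add: vec_eq_iff mat_def)

lemma real_matrix_transpose: "real_matrix (transpose M) = transpose (real_matrix M)"
  by (simp add: vec_eq_iff transpose_def)

lemma GL_int_inverse:
  assumes "M \<in> carrier GL_int"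
  obtains N where "N \<in> carrier GL_int" "M ** N = mat 1" "N ** M = mat 1"
  using assms by (auto simp: GL_int_def invertible_def)

text \<open>Transposing the two inverse equations exhibits an inverse. This closure is what lets
  invariance of the decomposition under \<open>cone_transform\<close> be used for pullbacks.\<close>

lemma GL_int_transpose:
  assumes "M \<in> carrier GL_int"
  shows "transpose M \<in> carrier GL_int"
proof -
  obtain N where "M ** N = mat 1" "N ** M = mat 1"
    using GL_int_inverse[OF assms] by metis
  then have "transpose N ** transpose M = mat 1" "transpose M ** transpose N = mat 1"
    by (metis matrix_transpose_mul transpose_mat)+
  then show ?thesis
    by (auto simp: GL_int_def invertible_def)
qed

lemma GL_int_mult:
  assumes "M \<in> carrier GL_int" "N \<in> carrier GL_int"
  shows "M ** N \<in> carrier GL_int"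
proof -
  obtain M' where M': "M ** M' = mat 1" "M' ** M = mat 1"
    using GL_int_inverse[OF assms(1)] by metis
  obtain N' where N': "N ** N' = mat 1" "N' ** N = mat 1"
    using GL_int_inverse[OF assms(2)] by metis
  have "(M ** N) ** (N' ** M') = mat 1" "(N' ** M') ** (M ** N) = mat 1"
    using M' N' by (metis matrix_mul_assoc matrix_mul_lid)+
  then show ?thesis
    by (auto simp: GL_int_def invertible_def)
qed

lemma group_GL_int: "group GL_int"
proof (rule groupI)
  fix M N :: "int^'g^'g"
  assume "M \<in> carrier GL_int" "N \<in> carrier GL_int"
  then show "M \<otimes>\<^bsub>GL_int\<^esub> N \<in> carrier GL_int"
    using GL_int_mult by (simp add: GL_int_def)
next
  show "\<one>\<^bsub>GL_int\<^esub> \<in> carrier (GL_int :: (int^'g^'g) monoid)"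
    by (auto simp: GL_int_def invertible_def intro: exI[of _ "mat 1"])
next
  fix M :: "int^'g^'g"
  assume "M \<in> carrier GL_int"
  then show "\<exists>N\<in>carrier GL_int. N \<otimes>\<^bsub>GL_int\<^esub> M = \<one>\<^bsub>GL_int\<^esub>"
    by (metis GL_int_inverse monoid.simps(1) monoid.simps(2) GL_int_def)
qed (auto simp: GL_int_def matrix_mul_assoc)

section \<open>Pulling back forms along integer matrices\<close>

definition pullback_form :: "int^'g^'g \<Rightarrow> real^'g^'g \<Rightarrow> real^'g^'g" where
  "pullback_form M X = transpose (real_matrix M) ** X ** real_matrix M"

lemma cone_transform_transpose: "cone_transform (transpose M) \<sigma> = pullback_form M ` \<sigma>"
  by (simp add: cone_transform_def pullback_form_def real_matrix_transpose)

lemma pullback_form_one [simp]: "pullback_form (mat 1) X = X"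
  by (simp add: pullback_form_def real_matrix_one)

text \<open>Substitution is contravariant, so the order of the factors is reversed; this is why
  changing markings gives a right action.\<close>

lemma pullback_form_mult: "pullback_form (M ** N) X = pullback_form N (pullback_form M X)"
  by (simp add: pullback_form_def real_matrix_mult matrix_transpose_mul matrix_mul_assoc)

lemma linear_pullback_form: "linear (pullback_form M)"
  by (rule linearI)
    (simp_all add: pullback_form_def vec_eq_iff matrix_matrix_mult_def sum.distrib algebra_simps
      sum_distrib_left)

lemma inner_pullback_form:
  "x \<bullet> (pullback_form M X *v x) = (real_matrix M *v x) \<bullet> (X *v (real_matrix M *v x))"
  by (simp add: pullback_form_def flip: matrix_vector_mul_assoc)
    (metis dot_lmul_matrix transpose_matrix_vector vector_transpose_matrix)

lemma pullback_form_symmetric: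
  assumes "X \<in> symmetric_matrices"
  shows "pullback_form M X \<in> symmetric_matrices"
  using assms by (simp add: symmetric_matrices_def pullback_form_def matrix_transpose_mul matrix_mul_assoc)

lemma pullback_form_integral:
  assumes "X \<in> integral_symmetric_matrices"
  shows "pullback_form M X \<in> integral_symmetric_matrices"
  using assms pullback_form_symmetric[of X M]
  by (auto simp: integral_symmetric_matrices_def pullback_form_def matrix_matrix_mult_def transpose_def
      intro!: Ints_sum Ints_mult)

text \<open>Invertibility of \<open>M\<close> keeps nonzero vectors nonzero, so strict positivity
  survives the substitution.\<close>

lemma pullback_form_Omega:
  assumes "M \<in> carrier GL_int" "X \<in> Omega"
  shows "pullback_form M X \<in> Omega"
proof -
  obtain N where "N ** M = mat 1"
    using GL_int_inverse[OF assms(1)] by metis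
  then have "real_matrix N *v (real_matrix M *v x) = x" for x
    by (metis matrix_vector_mul_assoc matrix_vector_mul_lid real_matrix_mult real_matrix_one)
  then have "real_matrix M *v x \<noteq> 0" if "x \<noteq> 0" for x
    using that by (metis matrix_vector_mult_0_right)
  then show ?thesis
    using assms(2) pullback_form_symmetric[of X M]
    by (simp add: Omega_def inner_pullback_form)
qed

lemma pullback_form_inverse:
  assumes "M \<in> carrier GL_int"
  obtains N where "N \<in> carrier GL_int"
    "\<And>X. pullback_form N (pullback_form M X) = X" "\<And>X. pullback_form M (pullback_form N X) = X"
  using GL_int_inverse[OF assms] by (metis pullback_form_mult pullback_form_one)

lemma inj_pullback_form: "M \<in> carrier GL_int \<Longrightarrow> inj (pullback_form M)"
  by (metis injI pullback_form_inverse)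

text \<open>Stability under the whole group includes stability under the inverse pullback, which
  supplies the missing inclusion. It is applied to the lattice of integral forms and to
  \<open>Omega\<close>.\<close>

lemma pullback_form_image_eq:
  assumes "\<And>M X. M \<in> carrier GL_int \<Longrightarrow> X \<in> S \<Longrightarrow> pullback_form M X \<in> S" "M \<in> carrier GL_int"
  shows "pullback_form M ` S = S"
  using assms(1) pullback_form_inverse[OF assms(2)] assms(2)
  by (metis (no_types, lifting) image_eqI image_subset_iff subsetI subset_antisym)

text \<open>Injectivity lets the image commute with the intersection, linearity carries spans to
  spans, and the lattice is mapped onto itself.\<close>

lemma lattice_cone_iso_pullback_form:
  assumes "M \<in> carrier GL_int"
  shows "lattice_cone_iso integral_symmetric_matrices \<sigma> (pullback_form M ` \<sigma>) (pullback_form M)"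
proof -
  have "pullback_form M ` (integral_symmetric_matrices \<inter> span \<sigma>)
      = integral_symmetric_matrices \<inter> span (pullback_form M ` \<sigma>)"
    using inj_pullback_form[OF assms] pullback_form_image_eq[OF pullback_form_integral assms]
    by (simp add: image_Int linear_pullback_form linear_span_image)
  then show ?thesis
    using inj_pullback_form[OF assms] linear_pullback_form
    by (auto simp: lattice_cone_iso_def intro: inj_on_subset)
qed

section \<open>The form of a marked tropical abelian variety\<close>

text \<open>By polarization the entries of \<open>form_matrix q\<close> are the values of the
  underlying bilinear form on pairs of axis vectors. Two bilinear maps that agree on the standard
  basis are equal, so the matrix represents \<open>q\<close>.\<close>

lemma quadratic_form_on_UNIV:
  fixes q :: "real^'g \<Rightarrow> real"
  assumes "quadratic_form_on UNIV q"
  shows "transpose (form_matrix q) = form_matrix q" "q x = x \<bullet> (form_matrix q *v x)"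
proof -
  obtain b where sym: "\<And>u v. b u v = b v u" and add: "\<And>u v w. b (u + v) w = b u w + b v w"
    and scale: "\<And>c u w. b (c *\<^sub>R u) w = c * b u w" and q: "\<And>v. q v = b v v"
    using assms unfolding quadratic_form_on_def by (metis UNIV_I)
  have add': "b w (u + v) = b w u + b w v" for u v w
    using add[of u v w] sym[of w] by simp
  have "b w (c *\<^sub>R u) = c * b w u" for c u w
    using scale[of c u w] sym[of w] by simp
  with add add' scale have "bilinear b"
    unfolding bilinear_def by (intro conjI allI linearI) simp_all
  have F: "form_matrix q $ i $ j = b (axis i 1) (axis j 1)" for i j
    by (simp add: form_matrix_def q add add' sym[of "axis j 1" "axis i 1"])
  then show "transpose (form_matrix q) = form_matrix q"
    by (simp add: vec_eq_iff transpose_def sym)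
  have "b = (\<lambda>x y. x \<bullet> (form_matrix q *v y))"
  proof (rule bilinear_eq_stdbasis[OF \<open>bilinear b\<close>])
    show "bilinear (\<lambda>x y. x \<bullet> (form_matrix q *v y))"
      unfolding bilinear_def
      by (auto intro!: linearI simp: inner_add_left inner_add_right matrix_vector_right_distrib
          matrix_vector_mult_scaleR)
  qed (auto simp: Basis_vec_def F inner_axis' matrix_vector_mul_component inner_axis)
  then show "q x = x \<bullet> (form_matrix q *v x)"
    by (metis q)
qed

lemma inner_symmetric_matrix:
  fixes X :: "real^'g^'g"
  assumes "transpose X = X"
  shows "u \<bullet> (X *v v) = v \<bullet> (X *v u)"
proof -
  have "u \<bullet> (X *v v) = (u v* X) \<bullet> v"
    by (simp add: dot_lmul_matrix)
  also have "\<dots> = v \<bullet> (transpose X *v u)"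
    by (simp add: inner_commute)
  finally show ?thesis
    by (simp only: assms)
qed

lemma quadratic_form_on_matrix:
  fixes X :: "real^'g^'g"
  assumes "transpose X = X"
  shows "quadratic_form_on UNIV (\<lambda>x. x \<bullet> (X *v x))"
  unfolding quadratic_form_on_def
proof (intro exI[of _ "\<lambda>x y. x \<bullet> (X *v y)"] conjI ballI allI)
  show "u \<bullet> (X *v v) = v \<bullet> (X *v u)" for u v
    using assms by (rule inner_symmetric_matrix)
qed (auto simp: inner_add_left)

lemma quadratic_form_on_compose:
  assumes "quadratic_form_on V Q" "linear f" "range f \<subseteq> V"
  shows "quadratic_form_on UNIV (Q \<circ> f)"
proof -
  obtain b where "\<forall>u\<in>V. \<forall>v\<in>V. b u v = b v u" "\<forall>u\<in>V. \<forall>v\<in>V. \<forall>w\<in>V. b (u + v) w = b u w + b v w"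
    "\<forall>c. \<forall>u\<in>V. \<forall>w\<in>V. b (c *\<^sub>R u) w = c * b u w" "\<forall>v\<in>V. Q v = b v v"
    using assms(1) unfolding quadratic_form_on_def by auto
  moreover have "f x \<in> V" for x
    using assms(3) by blast
  ultimately show ?thesis
    unfolding quadratic_form_on_def
    by (intro exI[of _ "\<lambda>u v. b (f u) (f v)"]) (simp add: linear_add linear_scale assms(2))
qed

section \<open>Null spaces and rational structure\<close>

lemma null_space_of_UNIV:
  fixes X :: "real^'g^'g"
  assumes "transpose X = X"
  shows "null_space_of UNIV (\<lambda>x. x \<bullet> (X *v x)) = {x. X *v x = 0}"
proof -
  \<comment> \<open>The null space condition thus says that \<open>w \<bullet> (X *v v) = 0\<close>
    for all \<open>w\<close>; the choice \<open>w = X *v v\<close> then forces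
    \<open>X *v v = 0\<close>.\<close>
  have "(v + w) \<bullet> (X *v (v + w)) = v \<bullet> (X *v v) + w \<bullet> (X *v w) + 2 * (w \<bullet> (X *v v))" for v w
    using inner_symmetric_matrix[OF assms, of v w]
    by (simp add: inner_add_left inner_add_right matrix_vector_right_distrib)
  then show ?thesis
    by (auto simp: null_space_of_def) (metis inner_eq_zero_iff)
qed

lemma null_space_of_compose:
  assumes "linear f" "bij_betw f UNIV V"
  shows "null_space_of UNIV (Q \<circ> f) = f -` null_space_of V Q"
proof -
  have V: "V = range f"
    using assms(2) by (simp add: bij_betw_def)
  show ?thesis
    unfolding V by (auto simp: null_space_of_def linear_add[OF assms(1)])
qed

text \<open>Clearing denominators reconciles the two notions of rationality: by coordinates in
  \<open>Omega_rt\<close>, by multiples lying in the lattice in \<open>marked_tavs\<close>.\<close>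

lemma rational_vectors_eq_rational_span: "rational_vectors = rational_span integer_vectors"
proof (intro Set.set_eqI iffI)
  fix v :: "real^'g"
  assume v: "v \<in> rational_vectors"
  have "\<exists>n::nat. n > 0 \<and> real n * v $ i \<in> \<int>" for i
  proof -
    have "v $ i \<in> \<rat>"
      using v by (simp add: rational_vectors_def)
    then obtain a b :: int where "b > 0" "v $ i = of_int a / of_int b"
      by (rule Rats_cases')
    then show ?thesis
      by (intro exI[of _ "nat b"]) auto
  qed
  then obtain d :: "'g \<Rightarrow> nat" where d: "\<And>i. d i > 0" "\<And>i. real (d i) * v $ i \<in> \<int>"
    by metis
  \<comment> \<open>The product of the denominators of all coordinates serves as a common
    denominator.\<close>
  have "real (\<Prod>j\<in>UNIV. d j) * v $ i \<in> \<int>" for i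
  proof -
    have "real (\<Prod>j\<in>UNIV. d j) * v $ i = real (\<Prod>j\<in>UNIV - {i}. d j) * (real (d i) * v $ i)"
      by (subst prod.remove[of _ i]) auto
    then show ?thesis
      using d(2) by (metis Ints_mult Ints_of_nat)
  qed
  moreover have "(\<Prod>j\<in>UNIV. d j) > 0"
    using d(1) by (simp add: prod_pos)
  ultimately show "v \<in> rational_span integer_vectors"
    unfolding rational_span_def integer_vectors_def
    by (intro CollectI exI[of _ "\<Prod>j\<in>UNIV. d j"]) (simp del: of_nat_prod)
next
  fix v :: "real^'g"
  assume "v \<in> rational_span integer_vectors"
  then obtain n :: nat where n: "n > 0" "\<And>i. real n * v $ i \<in> \<int>"
    by (auto simp: rational_span_def integer_vectors_def)
  have "v $ i \<in> \<rat>" for i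
  proof -
    have "v $ i = (real n * v $ i) / real n"
      using n(1) by simp
    moreover have "real n * v $ i \<in> \<rat>"
      using n(2) Ints_subset_Rats by blast
    ultimately show ?thesis
      by (metis Rats_divide Rats_of_nat)
  qed
  then show "v \<in> rational_vectors"
    by (simp add: rational_vectors_def)
qed

text \<open>Multiplication by \<open>n\<close> commutes with \<open>f\<close>, and injectivity lets
  membership in the image lattice be tested before applying \<open>f\<close>. It carries rationality
  from \<open>V\<close> back to the standard lattice.\<close>

lemma rational_span_linear_image:
  assumes "linear f" "inj f"
  shows "f -` rational_span (f ` \<Lambda>) = rational_span \<Lambda>"
  using assms by (auto simp: rational_span_def linear_scale[symmetric] inj_image_mem_iff)

lemma full_lattice_integer_vectors: "full_lattice UNIV (integer_vectors :: (real^'g) set)"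
  unfolding full_lattice_def
proof (intro exI[of _ Basis] conjI)
  show "(integer_vectors :: (real^'g) set) = {\<Sum>b\<in>Basis. of_int (c b) *\<^sub>R b | c. True}" (is "_ = ?S")
  proof (intro Set.set_eqI iffI)
    fix x :: "real^'g"
    assume "x \<in> integer_vectors"
    \<comment> \<open>The coordinates are integers, so taking floors recovers them as integer
      coefficients.\<close>
    then have "of_int \<lfloor>x \<bullet> b\<rfloor> = x \<bullet> b" if "b \<in> Basis" for b
      using that by (auto simp: integer_vectors_def Basis_vec_def inner_axis Ints_def image_iff)
    then have "(\<Sum>b\<in>Basis. of_int \<lfloor>x \<bullet> b\<rfloor> *\<^sub>R b) = (\<Sum>b\<in>Basis. (x \<bullet> b) *\<^sub>R b)"
      by (intro sum.cong) auto
    also have "\<dots> = x"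
      by (rule euclidean_representation)
    finally have "x = (\<Sum>b\<in>Basis. of_int \<lfloor>x \<bullet> b\<rfloor> *\<^sub>R b)" ..
    then show "x \<in> ?S"
      by (intro CollectI exI[of _ "\<lambda>b. \<lfloor>x \<bullet> b\<rfloor>"]) simp
  next
    fix x :: "real^'g"
    assume "x \<in> ?S"
    then obtain c where x: "x = (\<Sum>b\<in>Basis. of_int (c b) *\<^sub>R b)"
      by blast
    have "x $ i = of_int (c (axis i 1))" for i
    proof -
      have "x $ i = x \<bullet> axis i 1"
        by (simp add: inner_axis)
      also have "\<dots> = of_int (c (axis i 1))"
        unfolding x by (rule inner_sum_left_Basis) simp
      finally show ?thesis .
    qed
    then show "x \<in> integer_vectors"
      by (simp add: integer_vectors_def)
  qed
qed (auto simp: independent_Basis)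

section \<open>The form of a marked variety and its behaviour under changes of marking\<close>

abbreviation tav_form :: "('g::finite, 'v::real_vector) marked_tav \<Rightarrow> real^'g^'g" where
  "tav_form A \<equiv> form_matrix (qform A \<circ> marking A)"

lemma quadratic_form_marked_tav:
  assumes "A \<in> marked_tavs"
  shows "quadratic_form_on UNIV (qform A \<circ> marking A)"
  using assms by (intro quadratic_form_on_compose) (auto simp: marked_tavs_def bij_betw_def)

text \<open>The kernel of the matrix is the preimage of the null space under the marking. Since the
  marking matches the lattices, a rational basis of the null space pulls back to rational vectors
  spanning the kernel.\<close>

lemma tav_form_mem_Omega_rt:
  assumes A: "A \<in> marked_tavs"
  shows "tav_form A \<in> Omega_rt"
proof -
  let ?f = "marking A" and ?X = "tav_form A"
  let ?N = "null_space_of (vspace A) (qform A)"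
  have f: "linear ?f" "bij_betw ?f UNIV (vspace A)" "inj ?f" "?f ` integer_vectors = period_lattice A"
    and pos: "\<And>x. qform A (?f x) \<ge> 0"
    using A by (auto simp: marked_tavs_def bij_betw_def)
  obtain B where B: "B \<subseteq> rational_span (period_lattice A)" "span B = ?N"
    using A unfolding marked_tavs_def by blast
  note X = quadratic_form_on_UNIV[OF quadratic_form_marked_tav[OF A]]
  have ker: "{x. ?X *v x = 0} = ?f -` ?N"
  proof -
    have "qform A \<circ> ?f = (\<lambda>x. x \<bullet> (?X *v x))"
      using X(2) by (rule ext)
    then show ?thesis
      using null_space_of_UNIV[OF X(1)] null_space_of_compose[OF f(1,2), of "qform A"] by metis
  qed
  define C where "C = ?f -` B"
  \<comment> \<open>As \<open>B\<close> lies in the null space, hence in the range of the marking,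
    its preimage \<open>C\<close> is mapped onto it.\<close>
  have "B \<subseteq> range ?f"
    using B(2) span_superset[of B] f(2) by (auto simp: null_space_of_def bij_betw_def)
  then have "?f ` C = B"
    by (auto simp: C_def)
  then have "?f ` span C = ?N"
    by (metis B(2) f(1) linear_span_image)
  then have span_C: "span C = {x. ?X *v x = 0}"
    using ker f(3) by (metis inj_vimage_image_eq)
  have "C \<subseteq> rational_vectors"
    using B(1) rational_span_linear_image[OF f(1,3), of integer_vectors]
    by (auto simp: C_def f(4) rational_vectors_eq_rational_span)
  \<comment> \<open>A maximal independent subset of the rational spanning set \<open>C\<close> is a
    rational basis of the kernel.\<close>
  moreover obtain D where "D \<subseteq> C" "independent D" "C \<subseteq> span D"
    using maximal_independent_subset by blast
  moreover from this have "span D = span C"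
    by (metis span_mono span_span subset_antisym)
  ultimately have "\<exists>D\<subseteq>rational_vectors. independent D \<and> span D = {x. ?X *v x = 0}"
    using span_C by (metis subset_trans)
  then show ?thesis
    using X pos by (simp add: Omega_rt_def symmetric_matrices_def flip: X(2))
qed

lemma tav_form_mem_Omega:
  assumes A: "A \<in> marked_pure_tavs"
  shows "tav_form A \<in> Omega"
proof -
  have A': "A \<in> marked_tavs" and pos: "\<And>v. v \<in> vspace A \<Longrightarrow> v \<noteq> 0 \<Longrightarrow> qform A v > 0"
    using A by (auto simp: marked_pure_tavs_def)
  note X = quadratic_form_on_UNIV[OF quadratic_form_marked_tav[OF A']]
  have f: "linear (marking A)" "inj (marking A)" "range (marking A) = vspace A"
    using A' by (auto simp: marked_tavs_def bij_betw_def)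
  have "qform A (marking A x) > 0" if "x \<noteq> 0" for x
    using that f pos by (metis linear_injective_0 rangeI)
  then show ?thesis
    using X by (simp add: Omega_def symmetric_matrices_def flip: X(2))
qed

text \<open>The new marking substitutes \<open>M x\<close> into the old form. The pulled back matrix
  is symmetric, so \<open>form_matrix\<close> recovers it from its quadratic form.\<close>

lemma tav_form_change_marking:
  assumes A: "A \<in> marked_tavs"
  shows "tav_form (change_marking M A) = pullback_form M (tav_form A)"
proof -
  note X = quadratic_form_on_UNIV[OF quadratic_form_marked_tav[OF A]]
  have "qform (change_marking M A) \<circ> marking (change_marking M A)
      = (\<lambda>x. x \<bullet> (pullback_form M (tav_form A) *v x))"
    using X(2) by (auto simp: change_marking_def inner_pullback_form)
  moreover have "transpose (pullback_form M (tav_form A)) = pullback_form M (tav_form A)"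
    using X(1) pullback_form_symmetric[of "tav_form A" M] by (simp add: symmetric_matrices_def)
  ultimately show ?thesis
    by (simp add: form_matrix_eq)
qed

section \<open>Standard representatives realizing every form\<close>

definition standard_tav :: "real^'g^'g \<Rightarrow> ('g::finite, real^'g) marked_tav" where
  "standard_tav X = \<lparr>vspace = UNIV, period_lattice = integer_vectors,
     qform = (\<lambda>x. x \<bullet> (X *v x)), marking = id\<rparr>"

lemma tav_form_standard_tav:
  assumes "X \<in> symmetric_matrices"
  shows "tav_form (standard_tav X) = X"
  using assms by (simp add: standard_tav_def symmetric_matrices_def form_matrix_eq)

lemma standard_tav_mem_marked_tavs:
  assumes "X \<in> Omega_rt"
  shows "standard_tav X \<in> marked_tavs"
proof -
  have "transpose X = X"
    using assms by (simp add: Omega_rt_def symmetric_matrices_def)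
  then show ?thesis
    using assms
    by (simp add: marked_tavs_def standard_tav_def full_lattice_integer_vectors
        quadratic_form_on_matrix null_space_of_UNIV Omega_rt_def linear_id
        flip: rational_vectors_eq_rational_span)
qed

lemma Omega_subset_Omega_rt: "Omega \<subseteq> Omega_rt"
proof
  fix X :: "real^'g^'g"
  assume X: "X \<in> Omega"
  then have pos: "x \<bullet> (X *v x) > 0" if "x \<noteq> 0" for x
    using that by (simp add: Omega_def)
  have "x \<bullet> (X *v x) \<ge> 0" for x
    using pos[of x] by (cases "x = 0") auto
  \<comment> \<open>A positive definite form has trivial kernel, with the empty set as its rational
    basis.\<close>
  moreover have "span {} = {x. X *v x = 0}"
    using pos by force
  ultimately show "X \<in> Omega_rt"
    using X independent_empty empty_subsetI unfolding Omega_def Omega_rt_def by blast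
qed

lemma standard_tav_mem_marked_pure_tavs:
  assumes "X \<in> Omega"
  shows "standard_tav X \<in> marked_pure_tavs"
  using assms standard_tav_mem_marked_tavs[of X] Omega_subset_Omega_rt
  by (auto simp: marked_pure_tavs_def standard_tav_def Omega_def)

text \<open>Standard representatives give surjectivity. This guarantees that an action defined
  through representatives reaches every point of the glued space.\<close>

lemma tav_form_image_marked_tavs:
  "tav_form ` (marked_tavs :: ('g::finite, real^'g) marked_tav set) = Omega_rt"
proof (intro subset_antisym subsetI)
  fix X :: "real^'g^'g"
  assume X: "X \<in> Omega_rt"
  then have "X \<in> symmetric_matrices"
    by (simp add: Omega_rt_def)
  then show "X \<in> tav_form ` (marked_tavs :: ('g, real^'g) marked_tav set)"
    using standard_tav_mem_marked_tavs[OF X]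
    by (intro image_eqI[where x = "standard_tav X"]) (simp_all only: tav_form_standard_tav)
next
  fix X :: "real^'g^'g"
  assume "X \<in> tav_form ` (marked_tavs :: ('g, real^'g) marked_tav set)"
  then show "X \<in> Omega_rt"
    using tav_form_mem_Omega_rt by (elim imageE) simp
qed

lemma tav_form_image_marked_pure_tavs:
  "tav_form ` (marked_pure_tavs :: ('g::finite, real^'g) marked_tav set) = Omega"
proof (intro subset_antisym subsetI)
  fix X :: "real^'g^'g"
  assume X: "X \<in> Omega"
  then have "X \<in> symmetric_matrices"
    by (simp add: Omega_def)
  then show "X \<in> tav_form ` (marked_pure_tavs :: ('g, real^'g) marked_tav set)"
    using standard_tav_mem_marked_pure_tavs[OF X]
    by (intro image_eqI[where x = "standard_tav X"]) (simp_all only: tav_form_standard_tav)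
next
  fix X :: "real^'g^'g"
  assume "X \<in> tav_form ` (marked_pure_tavs :: ('g, real^'g) marked_tav set)"
  then show "X \<in> Omega"
    using tav_form_mem_Omega by (elim imageE) simp
qed

section \<open>Spaces glued from cones meeting in common faces\<close>

text \<open>Isolates what \<open>\<Sigma>\<close> and its restriction to \<open>Omega\<close> have
  in common, so that both versions are handled at once. The nonemptiness condition in
  \<open>meet\<close> accommodates restricted cones, which may be disjoint.\<close>

locale face_compatible_cones =
  fixes K :: "(real^'g^'g) set set"
  assumes meet: "\<lbrakk>\<sigma> \<in> K; \<tau> \<in> K; \<sigma> \<inter> \<tau> \<noteq> {}\<rbrakk>
      \<Longrightarrow> \<sigma> \<inter> \<tau> \<in> K \<and> (\<sigma> \<inter> \<tau>) face_of \<sigma> \<and> (\<sigma> \<inter> \<tau>) face_of \<tau>"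
    and pullback_mem: "\<lbrakk>M \<in> carrier GL_int; \<sigma> \<in> K\<rbrakk> \<Longrightarrow> pullback_form M ` \<sigma> \<in> K"
begin

text \<open>A description of the gluing class that depends on the form alone and not on a chosen
  cone.\<close>

definition point_class :: "real^'g^'g \<Rightarrow> ((real^'g^'g) set \<times> (real^'g^'g)) set" where
  "point_class x = {\<tau> \<in> K. x \<in> \<tau>} \<times> {x}"

lemma glued_class_eq:
  assumes "\<sigma> \<in> K" "x \<in> \<sigma>"
  shows "glued_class K \<sigma> x = point_class x"
proof -
  define F where "F = {((\<tau>, x), (\<sigma>, x)) | \<tau> \<sigma> x. \<tau> \<in> K \<and> \<sigma> \<in> K \<and> \<tau> face_of \<sigma> \<and> x \<in> \<tau>}"
  have glue: "face_gluing K = (F \<union> F\<inverse>)\<^sup>*"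
    unfolding face_gluing_def Let_def F_def ..
  \<comment> \<open>Each gluing move preserves the form and stays among the cones of
    \<open>K\<close> that contain it.\<close>
  have "snd p = x \<and> fst p \<in> K \<and> x \<in> fst p" if "((\<sigma>, x), p) \<in> (F \<union> F\<inverse>)\<^sup>*" for p
    using that
  proof (induction rule: rtrancl_induct)
    case base
    then show ?case using assms by simp
  next
    case (step p r)
    then show ?case
      using face_of_imp_subset by (fastforce simp: F_def)
  qed
  \<comment> \<open>Conversely, any two cones containing \<open>x\<close> are linked by two moves
    through their intersection, a common face belonging to \<open>K\<close>.\<close>
  moreover have "((\<sigma>, x), (\<tau>, x)) \<in> (F \<union> F\<inverse>)\<^sup>*" if "\<tau> \<in> K" "x \<in> \<tau>" for \<tau>
  proof -
    have "((\<sigma> \<inter> \<tau>, x), (\<sigma>, x)) \<in> F" "((\<sigma> \<inter> \<tau>, x), (\<tau>, x)) \<in> F"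
      using meet[of \<sigma> \<tau>] assms that by (auto simp: F_def)
    then show ?thesis
      by (meson UnI1 UnI2 converse.intros converse_rtrancl_into_rtrancl r_into_rtrancl)
  qed
  ultimately show ?thesis
    unfolding glued_class_def glue point_class_def by force
qed

text \<open>Some cone contains \<open>x\<close>, so the product is nonempty and its second factor
  can be read off.\<close>

lemma point_class_inject:
  assumes "x \<in> \<Union>K" "point_class x = point_class y"
  shows "x = y"
  using assms by (auto simp: point_class_def times_eq_iff)

lemma topspace_glued_space: "topspace (glued_space K) = point_class ` \<Union>K"
proof -
  have "topspace (glued_space K) = (\<Union>\<sigma>\<in>K. \<Union>x\<in>\<sigma>. {glued_class K \<sigma> x})"
    by (auto simp: glued_space_def quotient_def glued_class_def) blast+
  also have "\<dots> = point_class ` \<Union>K"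
    by (auto simp: glued_class_eq)
  finally show ?thesis .
qed

text \<open>All cones containing the form give the same class, so the definite description is well
  defined.\<close>

lemma moduli_point_eq:
  assumes "tav_form A \<in> \<Union>K"
  shows "moduli_point K A = point_class (tav_form A)"
proof -
  have "(\<exists>\<sigma>\<in>K. tav_form A \<in> \<sigma> \<and> p = glued_class K \<sigma> (tav_form A)) \<longleftrightarrow> p = point_class (tav_form A)" for p
    using assms by (auto simp: glued_class_eq)
  then show ?thesis
    unfolding moduli_point_def Let_def by simp
qed

lemma pullback_form_mem:
  assumes "M \<in> carrier GL_int" "x \<in> \<Union>K"
  shows "pullback_form M x \<in> \<Union>K"
  using assms pullback_mem by blast

section \<open>The action induced by changing markings\<close>

context
  fixes T :: "('g, real^'g) marked_tav set"
  assumes T: "T \<subseteq> marked_tavs" "tav_form ` T = \<Union>K"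
begin

text \<open>Well-definedness of the action: objects with equal moduli points have equal forms, hence
  equal forms after the change of marking. An object of \<open>T\<close> realizing \<open>x\<close>
  exists, which makes the described value unique.\<close>

lemma marking_action_point_class:
  assumes M: "M \<in> carrier GL_int" and x: "x \<in> \<Union>K"
  shows "marking_action T K M (point_class x) = point_class (pullback_form M x)"
proof -
  have change: "moduli_point K (change_marking M A) = point_class (pullback_form M x)"
    if A: "A \<in> T" "moduli_point K A = point_class x" for A
  proof -
    have "tav_form A \<in> \<Union>K"
      using A(1) T(2) by blast
    then have "tav_form A = x"
      using A(2) moduli_point_eq point_class_inject by metis
    then have "tav_form (change_marking M A) = pullback_form M x"
      using tav_form_change_marking A(1) T(1) by blast
    then show ?thesis
      using moduli_point_eq[of "change_marking M A"] pullback_form_mem[OF M x] by simp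
  qed
  have "x \<in> tav_form ` T"
    using T(2) x by (simp only:)
  then obtain A where A: "A \<in> T" "tav_form A = x"
    by blast
  then have "moduli_point K A = point_class x"
    using moduli_point_eq[of A] x by simp
  with A(1) change show ?thesis
    unfolding marking_action_def by (intro the_equality) metis+
qed

text \<open>Here \<open>A\<close> may live in any ambient space, since both sides depend only on its
  form.\<close>

lemma marking_action_moduli_point:
  fixes A :: "('g, 'v::real_vector) marked_tav"
  assumes "M \<in> carrier GL_int" "A \<in> marked_tavs" "tav_form A \<in> \<Union>K"
  shows "marking_action T K M (moduli_point K A) = moduli_point K (change_marking M A)"
  using assms moduli_point_eq[of A] moduli_point_eq[of "change_marking M A"]
    marking_action_point_class tav_form_change_marking[OF assms(2)] pullback_form_mem
  by metis

lemma continuous_map_marking_action: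
  assumes M: "M \<in> carrier GL_int"
  shows "continuous_map (glued_space K) (glued_space K) (marking_action T K M)"
proof -
  let ?S = "sum_topology top_of_set K" and ?\<pi> = "\<lambda>p. face_gluing K `` {p}"
  \<comment> \<open>This lifts the action to the disjoint union by moving the cone together with the
    form.\<close>
  let ?f = "\<lambda>(\<sigma>, x). (pullback_form M ` \<sigma>, pullback_form M x)"
  have \<pi>: "quotient_map ?S (glued_space K) ?\<pi>"
    unfolding glued_space_def by (rule quotient_map_quotient_topology)
  have "continuous_map ?S ?S ?f"
    unfolding continuous_map_def
  proof (intro conjI allI impI)
    show "?f \<in> topspace ?S \<rightarrow> topspace ?S"
      using pullback_mem[OF M] by auto
    fix U
    assume U: "openin ?S U"
    \<comment> \<open>Openness in the disjoint union is tested cone by cone, where the lift is the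
      restriction of a continuous linear map.\<close>
    have "openin (top_of_set \<sigma>) {x \<in> \<sigma>. ?f (\<sigma>, x) \<in> U}" if \<sigma>: "\<sigma> \<in> K" for \<sigma>
    proof -
      have "openin (top_of_set (pullback_form M ` \<sigma>)) {y. (pullback_form M ` \<sigma>, y) \<in> U}"
        using U pullback_mem[OF M \<sigma>] by (simp add: openin_sum_topology)
      moreover have "continuous_map (top_of_set \<sigma>) (top_of_set (pullback_form M ` \<sigma>)) (pullback_form M)"
        by (simp add: linear_continuous_on linear_pullback_form linear_linear)
      ultimately have "openin (top_of_set \<sigma>) {x \<in> topspace (top_of_set \<sigma>).
          pullback_form M x \<in> {y. (pullback_form M ` \<sigma>, y) \<in> U}}"
        using openin_continuous_map_preimage by blast
      then show ?thesis
        by simp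
    qed
    then show "openin ?S {p \<in> topspace ?S. ?f p \<in> U}"
      by (auto simp: openin_sum_topology)
  qed
  then have "continuous_map ?S (glued_space K) (?\<pi> \<circ> ?f)"
    using \<pi> continuous_map_compose quotient_imp_continuous_map by blast
  \<comment> \<open>The lift covers the action, so continuity descends through the quotient
    map.\<close>
  moreover have "(?\<pi> \<circ> ?f) p = (marking_action T K M \<circ> ?\<pi>) p" if p: "p \<in> topspace ?S" for p
  proof -
    obtain \<sigma> x where p: "p = (\<sigma>, x)" "\<sigma> \<in> K" "x \<in> \<sigma>"
      using p by auto
    then have "?\<pi> p = point_class x" "?\<pi> (?f p) = point_class (pullback_form M x)"
      using glued_class_eq pullback_mem[OF M] by (auto simp: glued_class_def)
    then show ?thesis
      using marking_action_point_class[OF M] p by auto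
  qed
  ultimately have "continuous_map ?S (glued_space K) (marking_action T K M \<circ> ?\<pi>)"
    by (rule continuous_map_eq)
  then show ?thesis
    using \<pi> continuous_compose_quotient_map by blast
qed

lemma admissible_marking_action:
  "admissible_action GL_int integral_symmetric_matrices K (marking_action T K)"
  unfolding admissible_action_def right_action_def
proof (intro conjI ballI)
  fix M :: "int^'g^'g" and \<sigma>
  assume M: "M \<in> carrier GL_int" and \<sigma>: "\<sigma> \<in> K"
  let ?\<tau> = "pullback_form M ` \<sigma>"
  have "marking_action T K M (glued_class K \<sigma> x) = glued_class K ?\<tau> (pullback_form M x)"
    if x: "x \<in> \<sigma>" for x
  proof -
    have "x \<in> \<Union>K"
      using \<sigma> x by blast
    then show ?thesis
      using glued_class_eq[OF \<sigma> x] glued_class_eq[OF pullback_mem[OF M \<sigma>] imageI[OF x]]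
        marking_action_point_class[OF M] by simp
  qed
  then show "\<exists>\<tau>\<in>K. \<exists>L. lattice_cone_iso integral_symmetric_matrices \<sigma> \<tau> L \<and>
      (\<forall>x\<in>\<sigma>. marking_action T K M (glued_class K \<sigma> x) = glued_class K \<tau> (L x))"
    using pullback_mem[OF M \<sigma>] lattice_cone_iso_pullback_form[OF M] by blast
next
  fix p
  assume "p \<in> topspace (glued_space K)"
  moreover have "mat 1 \<in> carrier (GL_int :: (int^'g^'g) monoid)"
    using group.is_monoid[OF group_GL_int] monoid.one_closed by (fastforce simp: GL_int_def)
  ultimately show "marking_action T K \<one>\<^bsub>GL_int\<^esub> p = p"
    using marking_action_point_class[of "mat 1"]
    by (auto simp: topspace_glued_space GL_int_def)
next
  fix M N :: "int^'g^'g" and p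
  assume MN: "M \<in> carrier GL_int" "N \<in> carrier GL_int"
  assume "p \<in> topspace (glued_space K)"
  then obtain x where x: "x \<in> \<Union>K" "p = point_class x"
    by (auto simp: topspace_glued_space)
  have "marking_action T K (M ** N) p = marking_action T K N (marking_action T K M p)"
    using MN x by (simp add: marking_action_point_class GL_int_mult pullback_form_mem pullback_form_mult
        del: Union_iff)
  then show "marking_action T K (M \<otimes>\<^bsub>GL_int\<^esub> N) p = marking_action T K N (marking_action T K M p)"
    by (simp add: GL_int_def)
qed (use group_GL_int continuous_map_marking_action in auto)

end

end

section \<open>The cones of the decomposition and their restrictions to \<open>Omega\<close>\<close>

lemma convex_Omega: "convex Omega"
  unfolding convex_def
proof (intro ballI allI impI)
  fix X Y :: "real^'g^'g" and u v :: real
  assume XY: "X \<in> Omega" "Y \<in> Omega" and uv: "0 \<le> u" "0 \<le> v" "u + v = 1"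
  have "transpose (u *\<^sub>R X + v *\<^sub>R Y) = u *\<^sub>R X + v *\<^sub>R Y"
    using XY by (auto simp: Omega_def symmetric_matrices_def transpose_def vec_eq_iff)
  moreover have "x \<bullet> ((u *\<^sub>R X + v *\<^sub>R Y) *v x) > 0" if "x \<noteq> 0" for x
  proof -
    have "x \<bullet> (X *v x) > 0" "x \<bullet> (Y *v x) > 0"
      using XY that by (auto simp: Omega_def)
    \<comment> \<open>If \<open>u = 0\<close> then \<open>v = 1\<close>; otherwise the first summand
      is positive and the second nonnegative.\<close>
    then have "u * (x \<bullet> (X *v x)) + v * (x \<bullet> (Y *v x)) > 0"
      using uv by (cases "u = 0") (simp_all add: add_pos_nonneg)
    then show ?thesis
      by (simp add: matrix_vector_mult_add_rdistrib inner_add_right flip: scaleR_matrix_vector_assoc)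
  qed
  ultimately show "u *\<^sub>R X + v *\<^sub>R Y \<in> Omega"
    by (simp add: Omega_def symmetric_matrices_def)
qed

lemma face_compatible_cones_decomposition:
  fixes \<Sigma> :: "(real^'g^'g) set set"
  assumes "admissible_decomposition \<Sigma>"
  shows "face_compatible_cones \<Sigma>"
proof
  fix M :: "int^'g^'g" and \<sigma>
  assume "M \<in> carrier GL_int" "\<sigma> \<in> \<Sigma>"
  then have "cone_transform (transpose M) \<sigma> \<in> \<Sigma>"
    using assms GL_int_transpose[of M] unfolding admissible_decomposition_def by blast
  then show "pullback_form M ` \<sigma> \<in> \<Sigma>"
    by (simp only: cone_transform_transpose)
next
  fix \<sigma> \<tau>
  assume "\<sigma> \<in> \<Sigma>" "\<tau> \<in> \<Sigma>" "\<sigma> \<inter> \<tau> \<noteq> {}"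
  with assms show "\<sigma> \<inter> \<tau> \<in> \<Sigma> \<and> (\<sigma> \<inter> \<tau>) face_of \<sigma> \<and> (\<sigma> \<inter> \<tau>) face_of \<tau>"
    unfolding admissible_decomposition_def by blast
qed

text \<open>Slicing by a convex set preserves the face relation, so convexity of
  \<open>Omega\<close> carries common faces to common faces. Pullbacks permute the slices because
  they map \<open>Omega\<close> onto itself.\<close>

lemma face_compatible_cones_restrict:
  fixes \<Sigma> :: "(real^'g^'g) set set"
  assumes "admissible_decomposition \<Sigma>"
  shows "face_compatible_cones (restrict_to_Omega \<Sigma>)"
proof
  interpret face_compatible_cones \<Sigma>
    using assms by (rule face_compatible_cones_decomposition)
  fix \<sigma> \<tau>
  assume "\<sigma> \<in> restrict_to_Omega \<Sigma>" "\<tau> \<in> restrict_to_Omega \<Sigma>" and ne: "\<sigma> \<inter> \<tau> \<noteq> {}"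
  then obtain \<sigma>' \<tau>' where st: "\<sigma> = \<sigma>' \<inter> Omega" "\<sigma>' \<in> \<Sigma>" "\<tau> = \<tau>' \<inter> Omega" "\<tau>' \<in> \<Sigma>"
    by (auto simp: restrict_to_Omega_def)
  have eq: "\<sigma> \<inter> \<tau> = (\<sigma>' \<inter> \<tau>') \<inter> Omega"
    using st by blast
  have meet': "\<sigma>' \<inter> \<tau>' \<in> \<Sigma>" "(\<sigma>' \<inter> \<tau>') face_of \<sigma>'" "(\<sigma>' \<inter> \<tau>') face_of \<tau>'"
    using meet[of \<sigma>' \<tau>'] ne st by blast+
  then have "\<sigma> \<inter> \<tau> \<in> restrict_to_Omega \<Sigma>"
    using ne unfolding restrict_to_Omega_def eq by blast
  then show "\<sigma> \<inter> \<tau> \<in> restrict_to_Omega \<Sigma> \<and> (\<sigma> \<inter> \<tau>) face_of \<sigma> \<and> (\<sigma> \<inter> \<tau>) face_of \<tau>"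
    using face_of_slice[OF meet'(2) convex_Omega] face_of_slice[OF meet'(3) convex_Omega] st(1,3) eq
    by simp
next
  interpret face_compatible_cones \<Sigma>
    using assms by (rule face_compatible_cones_decomposition)
  fix M :: "int^'g^'g" and \<sigma>
  assume M: "M \<in> carrier GL_int" and "\<sigma> \<in> restrict_to_Omega \<Sigma>"
  then obtain \<sigma>' where s: "\<sigma> = \<sigma>' \<inter> Omega" "\<sigma>' \<in> \<Sigma>" "\<sigma>' \<inter> Omega \<noteq> {}"
    by (auto simp: restrict_to_Omega_def)
  have "pullback_form M ` \<sigma> = pullback_form M ` \<sigma>' \<inter> Omega"
    using s(1) inj_pullback_form[OF M] pullback_form_image_eq[OF pullback_form_Omega M]
    by (simp add: image_Int)
  then show "pullback_form M ` \<sigma> \<in> restrict_to_Omega \<Sigma>"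
    using pullback_mem[OF M s(2)] s(1,3) unfolding restrict_to_Omega_def by blast
qed

theorem lemma5p4p2:
  fixes \<Sigma> :: "(real^'g^'g) set set"
  assumes "admissible_decomposition \<Sigma>"
  shows
    "(\<forall>M\<in>carrier GL_int. \<forall>A\<in>(marked_tavs :: ('g, 'v::real_vector) marked_tav set).
        siegel_action \<Sigma> M (moduli_point \<Sigma> A) = moduli_point \<Sigma> (change_marking M A)) \<and>
     admissible_action GL_int integral_symmetric_matrices \<Sigma> (siegel_action \<Sigma>) \<and>
     (\<forall>M\<in>carrier GL_int. \<forall>A\<in>(marked_pure_tavs :: ('g, 'v::real_vector) marked_tav set).
        pure_siegel_action \<Sigma> M (moduli_point (restrict_to_Omega \<Sigma>) A) =
          moduli_point (restrict_to_Omega \<Sigma>) (change_marking M A)) \<and>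
     admissible_action GL_int integral_symmetric_matrices (restrict_to_Omega \<Sigma>)
       (pure_siegel_action \<Sigma>)"
proof -
  have \<Sigma>: "\<Union>\<Sigma> = Omega_rt"
    using assms by (simp add: admissible_decomposition_def)
  have "\<Union>(restrict_to_Omega \<Sigma>) = \<Union>\<Sigma> \<inter> Omega"
    by (auto simp: restrict_to_Omega_def)
  \<comment> \<open>Positive definite forms lie in \<open>Omega_rt\<close>, so the restricted cones
    cover all of \<open>Omega\<close>.\<close>
  then have \<Sigma>': "\<Union>(restrict_to_Omega \<Sigma>) = Omega"
    by (simp only: \<Sigma> Int_absorb1[OF Omega_subset_Omega_rt])
  interpret full: face_compatible_cones \<Sigma>
    using assms by (rule face_compatible_cones_decomposition)
  interpret pure: face_compatible_cones "restrict_to_Omega \<Sigma>"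
    using assms by (rule face_compatible_cones_restrict)
  have T: "tav_form ` (marked_tavs :: ('g, real^'g) marked_tav set) = \<Union>\<Sigma>"
    unfolding \<Sigma> by (rule tav_form_image_marked_tavs)
  have T': "tav_form ` (marked_pure_tavs :: ('g, real^'g) marked_tav set) = \<Union>(restrict_to_Omega \<Sigma>)"
    unfolding \<Sigma>' by (rule tav_form_image_marked_pure_tavs)
  have pure_subset: "marked_pure_tavs \<subseteq> marked_tavs"
    by (auto simp: marked_pure_tavs_def)
  show ?thesis
    unfolding siegel_action_def pure_siegel_action_def
  proof (intro conjI ballI)
    fix M :: "int^'g^'g" and A :: "('g, 'v) marked_tav"
    assume "M \<in> carrier GL_int" "A \<in> marked_tavs"
    then show "marking_action marked_tavs \<Sigma> M (moduli_point \<Sigma> A) =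
        moduli_point \<Sigma> (change_marking M A)"
      by (rule full.marking_action_moduli_point[OF subset_refl T])
        (simp only: \<Sigma> tav_form_mem_Omega_rt \<open>A \<in> marked_tavs\<close>)
  next
    fix M :: "int^'g^'g" and A :: "('g, 'v) marked_tav"
    assume M: "M \<in> carrier GL_int" and A: "A \<in> marked_pure_tavs"
    have "A \<in> marked_tavs" "tav_form A \<in> \<Union>(restrict_to_Omega \<Sigma>)"
      using A tav_form_mem_Omega[OF A] by (simp_all only: \<Sigma>' marked_pure_tavs_def mem_Collect_eq)
    then show "marking_action marked_pure_tavs (restrict_to_Omega \<Sigma>) M
        (moduli_point (restrict_to_Omega \<Sigma>) A) =
        moduli_point (restrict_to_Omega \<Sigma>) (change_marking M A)"
      by (rule pure.marking_action_moduli_point[OF pure_subset T' M])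
  qed (rule full.admissible_marking_action[OF subset_refl T]
      pure.admissible_marking_action[OF pure_subset T'])+
qed

end
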